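(* Let $B, \tilde{B} \in \mathbb{C}^{n\times n}$ and $v_1,\tilde v_1\in\mathbb{C}^n$, and let the following conditions hold: (a) $B - \tilde{B}^* = \tilde{F}_k \tilde{C}_k^* - C_k F_k^*$ for some $C_k, \tilde{C}_k, F_k, \tilde{F}_k \in \mathbb{C}^{n\times k}$; (b) for all $x\in\mathbb{C}^n$, $Bx \perp \tilde{C}_k$ (that is, $\tilde C_k^* B x = 0$), and for all $\tilde{x}\in\mathbb{C}^n$, $\tilde{B}\tilde{x} \perp C_k$ (that is, $C_k^*\tilde B\tilde x=0$); (c) $v_1 \perp \tilde{C}_k$ (that is, $\tilde C_k^*v_1=0$) and $\tilde{v}_1 \perp C_k$ (that is, $C_k^*\tilde v_1=0$). Let $v_1,\dots,v_m$ and $\tilde v_1,\dots,\tilde v_m$ be generated by the full recurrences $$\beta_{i+1,i}v_{i+1} = Bv_i - \beta_{ii}v_i - \beta_{i-1,i}v_{i-1} - \cdots - \beta_{1i}v_1,$$ $$\tilde\beta_{i+1,i}\tilde v_{i+1} = \tilde B\tilde v_i - \tilde\beta_{ii}\tilde v_i - \tilde\beta_{i-1,i}\tilde v_{i-1} - \cdots - \tilde\beta_{1i}\tilde v_1,$$ for $i\in\{1,2,\dots,m-1\}$, where the scalars $\beta_{ij},\tilde\beta_{ij}$ are determined by the constraints $$\tilde V_i^* V_i = I \quad\text{and}\quad \|v_i\| = 1 ,\qquad i=1,\dots,m,$$ with $V_i=[v_1\ \cdots\ v_i]$ and $\tilde V_i=[\tilde v_1\ \cdots\ \tilde v_i]$.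 Then $\beta_{ij}=0$ and $\tilde\beta_{ij}=0$ for $j>i+1$, which leads to the three-term recurrences $$\beta_{i+1,i}v_{i+1} = Bv_i - \beta_{ii}v_i - \beta_{i-1,i}v_{i-1},$$ $$\tilde\beta_{i+1,i}\tilde v_{i+1} = \tilde B\tilde v_i - \tilde\beta_{ii}\tilde v_i - \tilde\beta_{i-1,i}\tilde v_{i-1},$$ for $i\in\{1,2,\dots,m-1\}$.
   Context: Here $*$ denotes conjugate transpose and $\|\cdot\|$ the Euclidean norm. For a square matrix $K$ and a vector $v$, $\mathcal{K}^{i}(K,v)=\mathrm{span}\{v,Kv,\dots,K^{i-1}v\}$. The columns of $V_m$ and $\tilde V_m$ are bases of $\mathcal{K}^m(B,v_1)$ and $\mathcal{K}^m(\tilde B,\tilde v_1)$, respectively. Standing assumptions: for $i<m$, $\mathcal{K}^i(B,v_1)$ is not an invariant subspace of $B$ and $\mathcal{K}^i(\tilde B,\tilde v_1)$ is not an invariant subspace of $\tilde B$; and no breakdown occurs, i.e. $\tilde v_i^*v_i\neq 0$ for all $i$, so that vectors satisfying the recurrences and the constraints exist up to index $m$. The coefficients $\beta_{ij},\tilde\beta_{ij}$ are those appearing in the recurrences (second index $j\in\{1,\dots,m-1\}$, first index $i\in\{1,\dots,j+1\}$); in matrix form the recurrences read $BV_i=V_{i+1}\underline{H}_i$ and $\tilde B\tilde V_i=\tilde V_{i+1}\underline{\tilde H}_i$, where $\underline{H}_i,\underline{\tilde H}_i$ are the $(i+1)\times i$ upper Hessenberg matrices with entries $\beta_{lj}$,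 $\tilde\beta_{lj}$. For $i=1$ the terms involving $v_0$, $\tilde v_0$ are absent. *)

theory Defs
  imports Complex_Main "Jordan_Normal_Form.Schur_Decomposition" "Jordan_Normal_Form.VS_Connect"
begin

text \<open>For complex matrices \<^const>\<open>mat_adjoint\<close> is the conjugate transpose.
  Families of vectors and coefficients are indexed from 1, as in
  $v_1, \ldots, v_m$; the value at index 0 is never used.\<close>

definition krylov :: "nat \<Rightarrow> nat \<Rightarrow> complex mat \<Rightarrow> complex vec \<Rightarrow> complex vec set" where
  "krylov n i K v =
     LinearCombinations.module.span class_ring (module_vec TYPE(complex) n)
       {(K ^\<^sub>m l) *\<^sub>v v | l. l < i}"

definition invariant_under :: "complex mat \<Rightarrow> complex vec set \<Rightarrow> bool" where
  "invariant_under K W \<longleftrightarrow> (\<forall>x\<in>W. K *\<^sub>v x \<in> W)"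

definition euclid_norm :: "complex vec \<Rightarrow> real" where
  "euclid_norm v = sqrt (\<Sum>l<dim_vec v. (cmod (v $ l))\<^sup>2)"

definition first_cols :: "nat \<Rightarrow> (nat \<Rightarrow> complex vec) \<Rightarrow> nat \<Rightarrow> complex mat" where
  "first_cols n v i = mat_of_cols n (map v [1..<i+1])"

definition full_recurrence ::
  "nat \<Rightarrow> nat \<Rightarrow> complex mat \<Rightarrow> (nat \<Rightarrow> nat \<Rightarrow> complex) \<Rightarrow> (nat \<Rightarrow> complex vec) \<Rightarrow> bool" where
  "full_recurrence n m B \<beta> v \<longleftrightarrow>
     (\<forall>i\<in>{1..<m}. \<beta> (i+1) i \<cdot>\<^sub>v v (i+1) =
        B *\<^sub>v v i - finsum_vec TYPE(complex) n (\<lambda>l. \<beta> l i \<cdot>\<^sub>v v l) {1..i})"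

text \<open>For $i = 1$ the term with $v_0$ is absent.\<close>

definition three_term_recurrence ::
  "nat \<Rightarrow> nat \<Rightarrow> complex mat \<Rightarrow> (nat \<Rightarrow> nat \<Rightarrow> complex) \<Rightarrow> (nat \<Rightarrow> complex vec) \<Rightarrow> bool" where
  "three_term_recurrence n m B \<beta> v \<longleftrightarrow>
     (\<forall>i\<in>{1..<m}. \<beta> (i+1) i \<cdot>\<^sub>v v (i+1) =
        B *\<^sub>v v i - \<beta> i i \<cdot>\<^sub>v v i
          - (if i = 1 then 0\<^sub>v n else \<beta> (i-1) i \<cdot>\<^sub>v v (i-1)))"

end

theory Submission
  imports Defs
begin

text \<open>By biorthogonality, \<open>\<beta> l i = (B *\<^sub>v v i) \<bullet>c vt l\<close>. Conditions (b) and (c) propagate along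
  the recurrences, so every \<open>v i\<close> is orthogonal to \<open>Ct\<close> and every \<open>vt l\<close> to \<open>C\<close>; between such
  vectors (a) makes \<open>Bt\<close> act as the adjoint of \<open>B\<close>. Hence \<open>\<beta> l i = v i \<bullet>c (Bt *\<^sub>v vt l)\<close>, which
  vanishes for \<open>l + 1 < i\<close> because \<open>Bt *\<^sub>v vt l\<close> lies in the span of \<open>vt 1, \<dots>, vt (l + 1)\<close>.
  The propagation divides by \<open>\<beta> (i + 1) i\<close>, which is nonzero since otherwise
  \<open>krylov n i B (v 1)\<close>, being the span of \<open>v 1, \<dots>, v i\<close>, would be invariant under \<open>B\<close>.\<close>

section \<open>Adjoint matrices and biorthogonality entry by entry\<close>

lemma mat_adjoint_index:
  assumes "i < dim_col A" "j < dim_row A"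
  shows "mat_adjoint A $$ (i, j) = conjugate (A $$ (j, i))"
  using assms by (simp add: mat_adjoint_def mat_of_rows_def)

lemma mat_adjoint_carrier:
  "A \<in> carrier_mat nr nc \<Longrightarrow> mat_adjoint A \<in> carrier_mat nc nr"
  by (auto simp: mat_adjoint_def)

lemma cscalar_prod_mat_adjoint:
  fixes A :: "complex mat"
  assumes A: "A \<in> carrier_mat nr nc" and x: "x \<in> carrier_vec nc" and y: "y \<in> carrier_vec nr"
  shows "(A *\<^sub>v x) \<bullet>c y = x \<bullet>c (mat_adjoint A *\<^sub>v y)"
proof -
  have "(A *\<^sub>v x) \<bullet>c y = (\<Sum>i<nr. \<Sum>j<nc. A $$ (i, j) * x $ j * cnj (y $ i))"
    using assms by (simp add: scalar_prod_def sum_distrib_right atLeast0LessThan)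
  also have "\<dots> = (\<Sum>j<nc. \<Sum>i<nr. A $$ (i, j) * x $ j * cnj (y $ i))"
    by (rule sum.swap)
  also have "\<dots> = (\<Sum>j<nc. x $ j * cnj (\<Sum>i<nr. cnj (A $$ (i, j)) * y $ i))"
    by (simp add: sum_distrib_left mult_ac)
  also have "\<dots> = x \<bullet>c (mat_adjoint A *\<^sub>v y)"
    using assms mat_adjoint_carrier[OF A]
    by (simp add: scalar_prod_def atLeast0LessThan mat_adjoint_index)
  finally show ?thesis .
qed

lemma cscalar_prod_commute:
  fixes x y :: "complex vec"
  assumes "x \<in> carrier_vec n" "y \<in> carrier_vec n"
  shows "y \<bullet>c x = cnj (x \<bullet>c y)"
  using assms by (simp add: scalar_prod_def mult.commute)

text \<open>Row \<open>j - 1\<close> of the adjoint of \<open>W\<close> is the conjugate of the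
  column \<open>w j\<close>, so pairing \<open>v i\<close> with \<open>w j\<close> gives an entry of
  the matrix identity at index \<open>m\<close>. The shift by one arises because matrices are
  indexed from 0 and the families from 1.\<close>

lemma cscalar_prod_first_cols:
  assumes biorth: "\<forall>i\<in>{1..m}. mat_adjoint (first_cols n w i) * first_cols n v i = 1\<^sub>m i"
    and v: "\<forall>i\<in>{1..m}. v i \<in> carrier_vec n" and w: "\<forall>i\<in>{1..m}. w i \<in> carrier_vec n"
    and i: "i \<in> {1..m}" and j: "j \<in> {1..m}"
  shows "v i \<bullet>c w j = (if i = j then 1 else 0)"
proof -
  define V where "V = first_cols n v m"
  define W where "W = first_cols n w m"
  have V: "V \<in> carrier_mat n m" and W: "W \<in> carrier_mat n m"
    using mat_of_cols_carrier(1)[of n "map _ [1..<m+1]"]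
    by (simp_all add: V_def W_def first_cols_def del: upt_Suc)
  have "col V (i - 1) = v i" and "col W (j - 1) = w j"
    using i j v w
    by (auto simp: V_def W_def first_cols_def nth_append simp del: upt_Suc)
  moreover have "(mat_adjoint W * V) $$ (j - 1, i - 1) = (if i = j then 1 else 0)"
    using biorth i j by (auto simp: V_def W_def)
  moreover have "row (mat_adjoint W) (j - 1) = conjugate (col W (j - 1))"
    using W j mat_adjoint_carrier[OF W] by (intro eq_vecI) (auto simp: mat_adjoint_index)
  moreover have "v i \<in> carrier_vec n" "w j \<in> carrier_vec n"
    using v w i j by auto
  ultimately show ?thesis
    using V mat_adjoint_carrier[OF W] i j conjugate_vec_sprod_comm[of "v i" n "w j"]
    by (auto split: if_splits)
qed

section \<open>Coefficients of the full recurrence as scalar products\<close>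

lemma full_recurrenceD:
  assumes "full_recurrence n m B \<beta> v" "i \<in> {1..<m}"
  shows "\<beta> (i+1) i \<cdot>\<^sub>v v (i+1) =
    B *\<^sub>v v i - finsum_vec TYPE(complex) n (\<lambda>l. \<beta> l i \<cdot>\<^sub>v v l) {1..i}"
  using assms unfolding full_recurrence_def by blast

lemma finsum_vec_carrier:
  "(\<And>l. l \<in> I \<Longrightarrow> f l \<in> carrier_vec n) \<Longrightarrow> finsum_vec TYPE(complex) n f I \<in> carrier_vec n"
  by (rule finsum_vec_closed) auto

text \<open>Moving the sum to the other side makes \<open>\<beta> (i+1) i\<close> the coefficient of
  the last term: this is column \<open>i\<close> of the Hessenberg relation, paired with
  \<open>w\<close>. The product is bilinear, without conjugation, so that \<open>w\<close> can be a
  conjugated basis vector as well as a row of a matrix.\<close>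

lemma full_recurrence_scalar_prod:
  assumes rec: "full_recurrence n m B \<beta> v" and B: "B \<in> carrier_mat n n"
    and v: "\<forall>i\<in>{1..m}. v i \<in> carrier_vec n" and w: "w \<in> carrier_vec n" and i: "i \<in> {1..<m}"
  shows "(B *\<^sub>v v i) \<bullet> w = (\<Sum>l\<in>{1..i+1}. \<beta> l i * (v l \<bullet> w))"
proof -
  interpret vec_space "TYPE(complex)" n .
  let ?S = "finsum_vec TYPE(complex) n (\<lambda>l. \<beta> l i \<cdot>\<^sub>v v l) {1..i}"
  have S: "?S \<in> carrier_vec n"
    using v i by (intro finsum_vec_carrier) auto
  have vc: "v i \<in> carrier_vec n" "v (i+1) \<in> carrier_vec n"
    using v i by auto
  have "?S \<bullet> w = (\<Sum>l\<in>{1..i}. (\<beta> l i \<cdot>\<^sub>v v l) \<bullet> w)"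
    unfolding finsum_vec using v i w by (intro finsum_scalar_prod_sum) auto
  also have "\<dots> = (\<Sum>l\<in>{1..i}. \<beta> l i * (v l \<bullet> w))"
    using v i w by (intro sum.cong) auto
  finally have "?S \<bullet> w = (\<Sum>l\<in>{1..i}. \<beta> l i * (v l \<bullet> w))" .
  moreover have "\<beta> (i+1) i * (v (i+1) \<bullet> w) = (B *\<^sub>v v i) \<bullet> w - ?S \<bullet> w"
  proof -
    have "\<beta> (i+1) i * (v (i+1) \<bullet> w) = (\<beta> (i+1) i \<cdot>\<^sub>v v (i+1)) \<bullet> w"
      using vc w by simp
    also have "\<dots> = (B *\<^sub>v v i) \<bullet> w - ?S \<bullet> w"
      unfolding full_recurrenceD[OF rec i]
      using vc B S w by (intro minus_scalar_prod_distrib) auto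
    finally show ?thesis .
  qed
  ultimately show ?thesis
    by simp
qed

text \<open>Biorthogonality leaves at most one term of the sum. The value 0 for
  \<open>l > i + 1\<close> is the Hessenberg pattern; carried across the adjoint relation, it
  becomes the vanishing of the coefficients above the superdiagonal.\<close>

lemma full_recurrence_coeff:
  assumes rec: "full_recurrence n m B \<beta> v" and B: "B \<in> carrier_mat n n"
    and v: "\<forall>i\<in>{1..m}. v i \<in> carrier_vec n" and w: "\<forall>i\<in>{1..m}. w i \<in> carrier_vec n"
    and biorth: "\<And>i j. i \<in> {1..m} \<Longrightarrow> j \<in> {1..m} \<Longrightarrow> v i \<bullet>c w j = (if i = j then 1 else 0)"
    and i: "i \<in> {1..<m}" and l: "l \<in> {1..m}"
  shows "(B *\<^sub>v v i) \<bullet>c w l = (if l \<le> i + 1 then \<beta> l i else 0)"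
proof -
  have "(B *\<^sub>v v i) \<bullet>c w l = (\<Sum>p\<in>{1..i+1}. \<beta> p i * (v p \<bullet>c w l))"
    using w l by (intro full_recurrence_scalar_prod[OF rec B v _ i]) auto
  also have "\<dots> = (\<Sum>p\<in>{1..i+1}. if p = l then \<beta> p i else 0)"
    using i l by (intro sum.cong) (auto simp: biorth)
  also have "\<dots> = (if l \<le> i + 1 then \<beta> l i else 0)"
    using l by auto
  finally show ?thesis .
qed

section \<open>Spans, Krylov spaces and nonzero subdiagonal coefficients\<close>

lemma (in vec_space) minus_mem_span:
  assumes T: "T \<subseteq> carrier_vec n" and x: "x \<in> span T" and y: "y \<in> span T"
  shows "x - y \<in> span T"
proof -
  have "x \<in> carrier_vec n" "y \<in> carrier_vec n"
    using assms span_closed by auto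
  then have "x - y = x + (- 1) \<cdot>\<^sub>v y"
    by (intro eq_vecI) auto
  then show ?thesis
    using span_add1[OF _ x smult_in_span[OF T y, of "- 1"]] T by simp
qed

text \<open>The preimage of \<open>span T\<close> under \<open>A\<close> is a submodule, so it
  contains \<open>span S\<close> as soon as it contains \<open>S\<close>.\<close>

lemma (in vec_space) mult_mat_vec_mem_span:
  assumes A: "A \<in> carrier_mat n n" and S: "S \<subseteq> carrier_vec n" and T: "T \<subseteq> carrier_vec n"
    and img: "\<And>s. s \<in> S \<Longrightarrow> A *\<^sub>v s \<in> span T" and x: "x \<in> span S"
  shows "A *\<^sub>v x \<in> span T"
proof -
  interpret T: submodule class_ring "span T" V
    by (rule span_is_submodule) (simp add: T)
  let ?N = "{x \<in> carrier_vec n. A *\<^sub>v x \<in> span T}"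
  have "submodule class_ring ?N V"
  proof
    have "A *\<^sub>v 0\<^sub>v n = 0\<^sub>v n"
      using A by auto
    then show "\<zero>\<^bsub>V\<^esub> \<in> ?N"
      using T.zero_closed by simp
    show "v \<oplus>\<^bsub>V\<^esub> w \<in> ?N" if "v \<in> ?N" "w \<in> ?N" for v w
      using that A T.m_closed by (auto simp: mult_add_distrib_mat_vec)
    show "c \<odot>\<^bsub>V\<^esub> v \<in> ?N" if "c \<in> carrier class_ring" "v \<in> ?N" for c v
      using that A smult_in_span[OF T] by (auto simp: mult_mat_vec)
  qed auto
  then have "span S \<subseteq> ?N"
    using S img by (intro span_is_subset) auto
  then show ?thesis
    using x by auto
qed

lemma (in vec_space) finsum_mem_span:
  assumes T: "T \<subseteq> carrier_vec n" and f: "\<And>i. i \<in> I \<Longrightarrow> f i \<in> span T" and "finite I"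
  shows "finsum V f I \<in> span T"
  using \<open>finite I\<close> f
proof (induction I rule: finite_induct)
  case empty
  show ?case
    using span_is_submodule[of T] T submodule.zero_closed by fastforce
next
  case (insert i I)
  then have "f i \<in> carrier_vec n" "f \<in> I \<rightarrow> carrier_vec n"
    using T span_closed by auto
  then have "finsum V f (insert i I) = f i + finsum V f I"
    using insert by simp
  then show ?case
    using insert span_add1[of T] T by simp
qed

text \<open>Strong induction on \<open>j\<close>: placing \<open>v 1\<close>, ...,
  \<open>v j\<close> in the Krylov space divides by the earlier subdiagonal coefficients. The
  assumption that the current one is zero then makes the span of these vectors invariant and equal
  to the Krylov space.\<close>

lemma full_recurrence_subdiag_nonzero:
  assumes rec: "full_recurrence n m B \<beta> v" and B: "B \<in> carrier_mat n n"
    and v: "\<forall>i\<in>{1..m}. v i \<in> carrier_vec n"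
    and not_inv: "\<forall>i\<in>{1..<m}. \<not> invariant_under B (krylov n i B (v 1))"
    and j: "j \<in> {1..<m}"
  shows "\<beta> (j+1) j \<noteq> 0"
  using j
proof (induction j rule: less_induct)
  case (less j)
  note IH = less.IH and j = less.prems
  show ?case
  proof
    assume zero: "\<beta> (j+1) j = 0"
    interpret vec_space "TYPE(complex)" n .
    let ?G = "\<lambda>i. {(B ^\<^sub>m l) *\<^sub>v v 1 | l. l < i}"
    have kr: "krylov n i B (v 1) = span (?G i)" for i
      by (simp add: krylov_def)
    have v1: "v 1 \<in> carrier_vec n"
      using v less.prems by auto
    have pow: "B ^\<^sub>m Suc l *\<^sub>v v 1 = B *\<^sub>v (B ^\<^sub>m l *\<^sub>v v 1)" for l
    proof -
      \<comment> \<open>The matrix power takes its new factor on the right, whereas the next Krylov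
        vector needs it on the left.\<close>
      have "B ^\<^sub>m Suc l = B * B ^\<^sub>m l"
          using B assoc_mult_mat[OF B pow_carrier_mat[OF B] B] by (induction l) simp_all
      then show ?thesis
        using assoc_mult_mat_vec[OF B pow_carrier_mat[OF B] v1] by simp
    qed
    have G: "?G i \<subseteq> carrier_vec n" for i
      using v1 by (auto intro!: mult_mat_vec_carrier[OF pow_carrier_mat[OF B]])
    have Gmono: "span (?G i) \<subseteq> span (?G j)" if "i \<le> j" for i j
      using that by (intro span_is_monotone) auto
    have BG: "B *\<^sub>v x \<in> span (?G (i+1))" if "x \<in> span (?G i)" for x i
    proof (rule mult_mat_vec_mem_span[OF B G G _ that])
      fix s assume "s \<in> ?G i"
      then have "B *\<^sub>v s \<in> ?G (i+1)"
        using pow by (auto intro: exI[of _ "Suc _"])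
      then show "B *\<^sub>v s \<in> span (?G (i+1))"
        using in_own_span[of "?G (i+1)"] G[of "i+1"] by auto
    qed
    have vK: "v i \<in> span (?G i)" if "i \<in> {1..j}" for i
      using that
    proof (induction i rule: less_induct)
      case (less i)
      show ?case
      proof (cases "i = 1")
        case True
        have "B ^\<^sub>m 0 *\<^sub>v v 1 \<in> span (?G 1)"
          using in_own_span[of "?G 1"] G[of 1] by (auto simp del: pow_mat.simps)
        then show ?thesis
          using True B v1 by simp
      next
        case False
        then obtain p where p: "i = p + 1" "1 \<le> p" "p < j"
          using less.prems by (cases i) auto
        then have p_mem: "p \<in> {1..<m}"
          using j by auto
        have "\<beta> l p \<cdot>\<^sub>v v l \<in> span (?G i)" if "l \<in> {1..p}" for l
          using less.IH[of l] that p Gmono[of l i] G[of i]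
          by (intro smult_in_span) auto
        then have "finsum V (\<lambda>l. \<beta> l p \<cdot>\<^sub>v v l) {1..p} \<in> span (?G i)"
          using G by (intro finsum_mem_span) auto
        moreover have "B *\<^sub>v v p \<in> span (?G i)"
          using BG[of "v p" p] less.IH[of p] p by simp
        ultimately have "\<beta> (p+1) p \<cdot>\<^sub>v v (p+1) \<in> span (?G i)"
          unfolding full_recurrenceD[OF rec p_mem] finsum_vec
          using G by (intro minus_mem_span)
        \<comment> \<open>The outer induction hypothesis enters here: since \<open>p < j\<close>,
          the coefficient \<open>\<beta> (p+1) p\<close> can be inverted.\<close>
        from smult_in_span[OF G this, of "inverse (\<beta> (p+1) p)"] show ?thesis
          using IH[of p] p p_mem by (simp add: smult_smult_assoc)
      qed
    qed
    let ?S = "v ` {1..j}"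
    have S: "?S \<subseteq> carrier_vec n"
      using v less.prems by auto
    have vS: "v i \<in> span ?S" if "i \<in> {1..j}" for i
      using that in_own_span[of ?S] S by auto
    have Bv: "B *\<^sub>v v i \<in> span ?S" if "i \<in> {1..j}" for i
    proof -
      have i: "i \<in> {1..<m}" and vi: "v (i+1) \<in> carrier_vec n" "v i \<in> carrier_vec n"
        using that j v by auto
      let ?f = "finsum V (\<lambda>l. \<beta> l i \<cdot>\<^sub>v v l) {1..i}"
      have f: "?f \<in> span ?S"
        using that vS S by (intro finsum_mem_span smult_in_span) auto
      \<comment> \<open>For \<open>i < j\<close> the vector \<open>v (i+1)\<close> is itself a
        generator. For \<open>i = j\<close> it is not among the generators, but \<open>zero\<close>
        turns the term into a null multiple of \<open>v j\<close>.\<close>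
      have "\<beta> (i+1) i \<cdot>\<^sub>v v (i+1) \<in> span ?S"
      proof (cases "i = j")
        case True
        then have "\<beta> (i+1) i \<cdot>\<^sub>v v (i+1) = 0 \<cdot>\<^sub>v v i"
          using zero vi by (intro eq_vecI) auto
        then show ?thesis
          using smult_in_span[OF S vS[OF that]] by simp
      next
        case False
        then show ?thesis
          using that vS[of "i+1"] S by (intro smult_in_span) auto
      qed
      then have "\<beta> (i+1) i \<cdot>\<^sub>v v (i+1) + ?f \<in> span ?S"
        using span_add1[of ?S] f S by simp
      moreover have "\<beta> (i+1) i \<cdot>\<^sub>v v (i+1) + ?f = B *\<^sub>v v i"
        unfolding full_recurrenceD[OF rec i] finsum_vec
        using B vi span_closed[OF _ f] S by (intro eq_vecI) auto
      ultimately show ?thesis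
        by simp
    qed
    have BS: "B *\<^sub>v x \<in> span ?S" if "x \<in> span ?S" for x
      by (rule mult_mat_vec_mem_span[OF B S S _ that]) (use Bv in auto)
    \<comment> \<open>An invariant space containing \<open>v 1\<close> contains its images under all
      powers of \<open>B\<close>; this gives the inclusion of the Krylov space in
      \<open>span ?S\<close>.\<close>
    have "B ^\<^sub>m l *\<^sub>v v 1 \<in> span ?S" for l
    proof (induction l)
      case 0
      then show ?case
        using vS[of 1] less.prems B v1 by simp
    next
      case (Suc l)
      then show ?case
        unfolding pow by (rule BS)
    qed
    then have "span (?G j) \<subseteq> span ?S"
      using S by (intro span_subsetI) auto
    moreover have "span ?S \<subseteq> span (?G j)"
    proof (rule span_subsetI[OF G])
      show "?S \<subseteq> span (?G j)"
      proof
        fix x assume "x \<in> ?S"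
        then obtain i where "i \<in> {1..j}" "x = v i"
          by blast
        then show "x \<in> span (?G j)"
          using vK[of i] Gmono[of i j] by auto
      qed
    qed
    ultimately have "krylov n j B (v 1) = span ?S"
      unfolding kr by (rule subset_antisym)
    then have "invariant_under B (krylov n j B (v 1))"
      using BS unfolding invariant_under_def by simp
    then show False
      using not_inv less.prems by blast
  qed
qed

section \<open>Propagation of orthogonality along the recurrence\<close>

text \<open>Pair step \<open>p = i - 1\<close> of the recurrence with \<open>w\<close>: the term
  with \<open>B\<close> vanishes by assumption and the terms up to \<open>p\<close> by induction, so
  only \<open>\<beta> (p+1) p\<close> times the wanted product remains, and that coefficient is
  nonzero.\<close>

lemma full_recurrence_orthogonal:
  assumes rec: "full_recurrence n m B \<beta> v" and B: "B \<in> carrier_mat n n"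
    and v: "\<forall>i\<in>{1..m}. v i \<in> carrier_vec n"
    and subdiag: "\<And>i. i \<in> {1..<m} \<Longrightarrow> \<beta> (i+1) i \<noteq> 0"
    and w: "w \<in> carrier_vec n"
    and Bw: "\<And>x. x \<in> carrier_vec n \<Longrightarrow> (B *\<^sub>v x) \<bullet> w = 0" and v1: "v 1 \<bullet> w = 0"
    and i: "i \<in> {1..m}"
  shows "v i \<bullet> w = 0"
  using i
proof (induction i rule: less_induct)
  case (less i)
  show ?case
  proof (cases "i = 1")
    case False
    then obtain p where p: "i = p + 1" "p \<in> {1..<m}"
      using less.prems by (cases i) auto
    have "0 = (B *\<^sub>v v p) \<bullet> w"
      using Bw v p by auto
    also have "\<dots> = (\<Sum>l\<in>{1..p+1}. \<beta> l p * (v l \<bullet> w))"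
      by (rule full_recurrence_scalar_prod[OF rec B v w p(2)])
    also have "\<dots> = (\<Sum>l\<in>{1..p}. \<beta> l p * (v l \<bullet> w)) + \<beta> (p+1) p * (v (p+1) \<bullet> w)"
      by simp
    also have "(\<Sum>l\<in>{1..p}. \<beta> l p * (v l \<bullet> w)) = 0"
      using less.IH p by (intro sum.neutral) auto
    finally show ?thesis
      using subdiag[OF p(2)] p(1) by simp
  qed (use v1 in simp)
qed

text \<open>The preceding lemma is applied with \<open>w\<close> running through the rows of
  \<open>A\<close>; in the end \<open>A\<close> is the adjoint of \<open>Ct\<close> or of
  \<open>C\<close>.\<close>

lemma full_recurrence_kernel:
  assumes rec: "full_recurrence n m B \<beta> v" and B: "B \<in> carrier_mat n n"
    and A: "A \<in> carrier_mat k n"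
    and v: "\<forall>i\<in>{1..m}. v i \<in> carrier_vec n"
    and subdiag: "\<And>i. i \<in> {1..<m} \<Longrightarrow> \<beta> (i+1) i \<noteq> 0"
    and AB: "\<forall>x\<in>carrier_vec n. A *\<^sub>v (B *\<^sub>v x) = 0\<^sub>v k" and Av1: "A *\<^sub>v v 1 = 0\<^sub>v k"
    and i: "i \<in> {1..m}"
  shows "A *\<^sub>v v i = 0\<^sub>v k"
proof (rule eq_vecI)
  fix r assume "r < dim_vec (0\<^sub>v k)"
  then have r: "r < k" by simp
  have row: "y \<bullet> row A r = (A *\<^sub>v y) $ r" if "y \<in> carrier_vec n" for y
    using that A r by (simp add: comm_scalar_prod[of _ n])
  have "v 1 \<in> carrier_vec n"
    using v i by auto
  then have "v i \<bullet> row A r = 0"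
    using A B r AB Av1 by (intro full_recurrence_orthogonal[OF rec B v subdiag _ _ _ i]) (auto simp: row)
  then show "(A *\<^sub>v v i) $ r = 0\<^sub>v k $ r"
    using row v i r by auto
qed (use A in auto)

section \<open>Truncation of the recurrence to three terms\<close>

lemma three_term_recurrenceI:
  assumes rec: "full_recurrence n m B \<beta> v" and B: "B \<in> carrier_mat n n"
    and v: "\<forall>i\<in>{1..m}. v i \<in> carrier_vec n"
    and zero: "\<And>l i. 1 \<le> l \<Longrightarrow> l + 1 < i \<Longrightarrow> i < m \<Longrightarrow> \<beta> l i = 0"
  shows "three_term_recurrence n m B \<beta> v"
  unfolding three_term_recurrence_def
proof
  fix i assume i: "i \<in> {1..<m}"
  have vc: "v i \<in> carrier_vec n" "v (i+1) \<in> carrier_vec n"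
    using v i by auto
  let ?f = "\<lambda>l. \<beta> l i \<cdot>\<^sub>v v l"
  let ?u = "if i = 1 then 0\<^sub>v n else \<beta> (i-1) i \<cdot>\<^sub>v v (i-1)"
  have u: "?u \<in> carrier_vec n"
  proof (cases "i = 1")
    case False
    then have "i - 1 \<in> {1..m}"
      using i by auto
    then show ?thesis
      using v by simp
  qed simp
  have S: "finsum_vec TYPE(complex) n ?f {1..i} \<in> carrier_vec n"
    using v i by (intro finsum_vec_carrier) auto
  have "finsum_vec TYPE(complex) n ?f {1..i} = \<beta> i i \<cdot>\<^sub>v v i + ?u"
  proof (rule eq_vecI)
    fix r assume "r < dim_vec (\<beta> i i \<cdot>\<^sub>v v i + ?u)"
    then have r: "r < n"
      using u by auto
    have "finsum_vec TYPE(complex) n ?f {1..i} $ r = (\<Sum>l\<in>{1..i}. ?f l $ r)"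
      using v i r by (intro index_finsum_vec) auto
    \<comment> \<open>Intersecting with \<open>{1..}\<close> removes the index 0, which
      \<open>{i-1..i}\<close> contains when \<open>i = 1\<close>.\<close>
    also have "\<dots> = (\<Sum>l\<in>{i-1..i} \<inter> {1..}. ?f l $ r)"
    proof (rule sum.mono_neutral_right)
      show "\<forall>l\<in>{1..i} - {i - 1..i} \<inter> {1..}. ?f l $ r = 0"
      proof
        fix l assume "l \<in> {1..i} - {i - 1..i} \<inter> {1..}"
        then have "1 \<le> l" "l + 1 < i" by auto
        moreover from this have "v l \<in> carrier_vec n"
          using v i by auto
        ultimately show "?f l $ r = 0"
          using zero i r by simp
      qed
    qed auto
    also have "{i-1..i} \<inter> {1..} = (if i = 1 then {i} else {i, i - 1})"
      using i by auto
    also have "(\<Sum>l\<in>(if i = 1 then {i} else {i, i - 1}). ?f l $ r) = (\<beta> i i \<cdot>\<^sub>v v i + ?u) $ r"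
      using i r u vc by auto
    finally show "finsum_vec TYPE(complex) n ?f {1..i} $ r = (\<beta> i i \<cdot>\<^sub>v v i + ?u) $ r" .
  qed (use S u in auto)
  then have "\<beta> (i+1) i \<cdot>\<^sub>v v (i+1) = B *\<^sub>v v i - (\<beta> i i \<cdot>\<^sub>v v i + ?u)"
    using full_recurrenceD[OF rec i] by simp
  also have "\<dots> = B *\<^sub>v v i - \<beta> i i \<cdot>\<^sub>v v i - ?u"
    using u B vc by (intro eq_vecI) auto
  finally show "\<beta> (i+1) i \<cdot>\<^sub>v v (i+1) = B *\<^sub>v v i - \<beta> i i \<cdot>\<^sub>v v i - ?u" .
qed

section \<open>The adjoint relation modulo low rank\<close>

text \<open>Both low-rank terms disappear, for different reasons: \<open>Ft\<close> acts on the
  adjoint of \<open>Ct\<close> applied to \<open>x\<close>, which is zero, while the range of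
  \<open>C\<close> is orthogonal to \<open>y\<close>.\<close>

lemma cscalar_prod_low_rank_adjoint:
  fixes B Bt C Ct F Ft :: "complex mat"
  assumes B: "B \<in> carrier_mat n n" and Bt: "Bt \<in> carrier_mat n n"
    and C: "C \<in> carrier_mat n k" and Ct: "Ct \<in> carrier_mat n k"
    and F: "F \<in> carrier_mat n k" and Ft: "Ft \<in> carrier_mat n k"
    and diff: "B - mat_adjoint Bt = Ft * mat_adjoint Ct - C * mat_adjoint F"
    and x: "x \<in> carrier_vec n" "mat_adjoint Ct *\<^sub>v x = 0\<^sub>v k"
    and y: "y \<in> carrier_vec n" "mat_adjoint C *\<^sub>v y = 0\<^sub>v k"
  shows "(B *\<^sub>v x) \<bullet>c y = x \<bullet>c (Bt *\<^sub>v y)"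
proof -
  note adj = mat_adjoint_carrier
  have yc: "conjugate y \<in> carrier_vec n"
    using y by simp
  have Fx: "mat_adjoint F *\<^sub>v x \<in> carrier_vec k"
    using adj[OF F] x by auto
  have "(B *\<^sub>v x) \<bullet>c y - (mat_adjoint Bt *\<^sub>v x) \<bullet>c y = ((B - mat_adjoint Bt) *\<^sub>v x) \<bullet>c y"
    using B adj[OF Bt] x yc
    by (simp add: minus_mult_distrib_mat_vec[of _ n n] minus_scalar_prod_distrib[of _ n])
  also have "\<dots> = (Ft *\<^sub>v (mat_adjoint Ct *\<^sub>v x)) \<bullet>c y - (C *\<^sub>v (mat_adjoint F *\<^sub>v x)) \<bullet>c y"
  proof -
    have 1: "Ft * mat_adjoint Ct \<in> carrier_mat n n" "C * mat_adjoint F \<in> carrier_mat n n"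
      using adj[OF F] adj[OF Ct] C Ft by auto
    have "((B - mat_adjoint Bt) *\<^sub>v x) \<bullet>c y =
        ((Ft * mat_adjoint Ct) *\<^sub>v x) \<bullet>c y - ((C * mat_adjoint F) *\<^sub>v x) \<bullet>c y"
      unfolding diff using 1 x yc
      by (simp add: minus_mult_distrib_mat_vec[of _ n n] minus_scalar_prod_distrib[of _ n])
    then show ?thesis
      using assoc_mult_mat_vec[OF Ft adj[OF Ct] x(1)] assoc_mult_mat_vec[OF C adj[OF F] x(1)]
      by simp
  qed
  also have "(Ft *\<^sub>v (mat_adjoint Ct *\<^sub>v x)) \<bullet>c y = 0"
  proof -
    have "Ft *\<^sub>v 0\<^sub>v k = 0\<^sub>v n"
      using Ft by auto
    then show ?thesis
      using x yc by simp
  qed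
  also have "(C *\<^sub>v (mat_adjoint F *\<^sub>v x)) \<bullet>c y = 0"
    using cscalar_prod_mat_adjoint[OF C Fx y(1)] y(2) Fx by simp
  finally have "(B *\<^sub>v x) \<bullet>c y = (mat_adjoint Bt *\<^sub>v x) \<bullet>c y"
    by simp
  \<comment> \<open>The adjoint rule moves a matrix from the left factor to its adjoint on the
    right. Swapping the factors before and after applies it to \<open>Bt\<close> itself and avoids a
    double adjoint.\<close>
  also have "\<dots> = cnj (y \<bullet>c (mat_adjoint Bt *\<^sub>v x))"
    using adj[OF Bt] x y by (intro cscalar_prod_commute[of _ n]) auto
  also have "\<dots> = cnj ((Bt *\<^sub>v y) \<bullet>c x)"
    using cscalar_prod_mat_adjoint[OF Bt y(1) x(1)] by simp
  also have "\<dots> = x \<bullet>c (Bt *\<^sub>v y)"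
    using Bt x y by (intro cscalar_prod_commute[of _ n, symmetric]) auto
  finally show ?thesis .
qed

theorem theorem3p1:
  fixes n k m :: nat
    and B Bt C Ct F Ft :: "complex mat"
    and v vt :: "nat \<Rightarrow> complex vec"
    and \<beta> \<beta>t :: "nat \<Rightarrow> nat \<Rightarrow> complex"
  assumes B: "B \<in> carrier_mat n n" and Bt: "Bt \<in> carrier_mat n n"
    and C: "C \<in> carrier_mat n k" and Ct: "Ct \<in> carrier_mat n k"
    and F: "F \<in> carrier_mat n k" and Ft: "Ft \<in> carrier_mat n k"
    and v: "\<forall>i\<in>{1..m}. v i \<in> carrier_vec n"
    and vt: "\<forall>i\<in>{1..m}. vt i \<in> carrier_vec n"
    and cond_a: "B - mat_adjoint Bt = Ft * mat_adjoint Ct - C * mat_adjoint F"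
    and cond_b: "\<forall>x\<in>carrier_vec n. mat_adjoint Ct *\<^sub>v (B *\<^sub>v x) = 0\<^sub>v k"
    and cond_bt: "\<forall>x\<in>carrier_vec n. mat_adjoint C *\<^sub>v (Bt *\<^sub>v x) = 0\<^sub>v k"
    and cond_c: "mat_adjoint Ct *\<^sub>v v 1 = 0\<^sub>v k"
    and cond_ct: "mat_adjoint C *\<^sub>v vt 1 = 0\<^sub>v k"
    and not_inv: "\<forall>i\<in>{1..<m}. \<not> invariant_under B (krylov n i B (v 1))"
    and not_inv_t: "\<forall>i\<in>{1..<m}. \<not> invariant_under Bt (krylov n i Bt (vt 1))"
    and rec: "full_recurrence n m B \<beta> v"
    and rec_t: "full_recurrence n m Bt \<beta>t vt"
    and biorth: "\<forall>i\<in>{1..m}. mat_adjoint (first_cols n vt i) * first_cols n v i = 1\<^sub>m i"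
    and unit: "\<forall>i\<in>{1..m}. euclid_norm (v i) = 1"
  shows "(\<forall>i j. 1 \<le> i \<and> j < m \<and> j > i + 1 \<longrightarrow> \<beta> i j = 0 \<and> \<beta>t i j = 0)
    \<and> three_term_recurrence n m B \<beta> v
    \<and> three_term_recurrence n m Bt \<beta>t vt"
proof -
  note bi = cscalar_prod_first_cols[OF biorth v vt]
  \<comment> \<open>Conjugation exchanges the two families, so that the coefficient lemma also
    applies to \<open>rec_t\<close>.\<close>
  have bi': "vt i \<bullet>c v j = (if i = j then 1 else 0)" if "i \<in> {1..m}" "j \<in> {1..m}" for i j
    using cscalar_prod_commute[of "v j" n "vt i"] bi[OF that(2,1)] v vt that by auto
  note nz = full_recurrence_subdiag_nonzero[OF rec B v not_inv]
  note nzt = full_recurrence_subdiag_nonzero[OF rec_t Bt vt not_inv_t]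
  note Ctv = full_recurrence_kernel[OF rec B mat_adjoint_carrier[OF Ct] v nz cond_b cond_c]
  note Cvt = full_recurrence_kernel[OF rec_t Bt mat_adjoint_carrier[OF C] vt nzt cond_bt cond_ct]
  note coeff = full_recurrence_coeff[OF rec B v vt bi]
  note coeff_t = full_recurrence_coeff[OF rec_t Bt vt v bi']
  \<comment> \<open>\<open>Ctv\<close> and \<open>Cvt\<close> supply the orthogonality that the
    low-rank relation requires. The conjugated form puts \<open>Bt\<close> in the left factor, where
    \<open>coeff_t\<close> can evaluate the product.\<close>
  have adj: "(B *\<^sub>v v i) \<bullet>c vt j = cnj ((Bt *\<^sub>v vt j) \<bullet>c v i)" if "i \<in> {1..m}" "j \<in> {1..m}" for i j
  proof -
    have c: "v i \<in> carrier_vec n" "vt j \<in> carrier_vec n"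
      using v vt that by auto
    have "(B *\<^sub>v v i) \<bullet>c vt j = v i \<bullet>c (Bt *\<^sub>v vt j)"
      by (rule cscalar_prod_low_rank_adjoint[OF B Bt C Ct F Ft cond_a c(1) Ctv c(2) Cvt])
        (use that in auto)
    then show ?thesis
      using cscalar_prod_commute[of "Bt *\<^sub>v vt j" n "v i"] c Bt by simp
  qed
  \<comment> \<open>Here \<open>\<beta> i j\<close> is the product of \<open>B *\<^sub>v v j\<close>
    with \<open>vt i\<close>, hence the conjugate of that of \<open>Bt *\<^sub>v vt i\<close> with
    \<open>v j\<close>. The latter is 0 by \<open>coeff_t\<close> because \<open>j > i + 1\<close>.
    Exchanging the two families gives \<open>\<beta>t i j\<close>.\<close>
  have zero: "\<beta> i j = 0 \<and> \<beta>t i j = 0" if "1 \<le> i" "i + 1 < j" "j < m" for i j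
    using that adj[of j i] adj[of i j] coeff[of j i] coeff[of i j] coeff_t[of j i] coeff_t[of i j]
    by auto
  then show ?thesis
    using three_term_recurrenceI[OF rec B v] three_term_recurrenceI[OF rec_t Bt vt] by blast
qed

end
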